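(* Let $V$ be a finite set with $|V|>1$, let $(\mathsf Z_i : i\in V)$ be discrete random variables with entropy function $H$, let $R=R_{\mathrm{ACO}}(V)$, let $\mathcal P^*$ be the fundamental partition, and let $g$ be a separable convex function, $g(\mathbf r_X)=\sum_{i\in X}g_i(r_i)$ for $X\subseteq V$, with each $g_i:\mathbb R\to\mathbb R$ convex. For every $C\in\mathcal P^*$ let $\mathbf r^*_C$ be a minimizer of $$\min\{g(\mathbf r_C):\mathbf r_C\in B(\hat f^{\#}_{R,C},\le)\}.$$ Then $\mathbf r^*_V=\bigoplus_{C\in\mathcal P^*}\mathbf r^*_C$ is a minimizer of $\min\{g(\mathbf r_V):\mathbf r_V\in\mathscr R^*_{\mathrm{ACO}}(V)\}$.
   Context: For $X\subseteq V$, $H(X)$ is the (finite) Shannon entropy of $(\mathsf Z_i: i\in X)$, $H(\emptyset)=0$, $H(X|Y)=H(X\cup Y)-H(Y)$. For a vector $\mathbf r_X=(r_i:i\in X)$, $r(Y)=\sum_{i\in Y}r_i$ for $Y\subseteq X$; for disjoint $X,Y$, $\mathbf r_X\oplus\mathbf r_Y=\mathbf r_{X\sqcup Y}$ is the concatenation. $\mathscr R_{\mathrm{CO}}(V)=\{\mathbf r_V\in\mathbb R^{|V|}: r(X)\ge H(X|V\setminus X)\ \forall X\subsetneq V\}$; $R_{\mathrm{ACO}}(V)=\min\{r(V):\mathbf r_V\in\mathscr R_{\mathrm{CO}}(V)\}$; $\mathscr R^*_{\mathrm{ACO}}(V)=\{\mathbf r_V\in\mathscr R_{\mathrm{CO}}(V):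 r(V)=R_{\mathrm{ACO}}(V)\}$. $\Pi(X)$: partitions of $X$ into nonempty disjoint subsets; $\Pi'(V)=\{\mathcal P\in\Pi(V):|\mathcal P|>1\}$; $\varphi(\mathcal P)=\sum_{C\in\mathcal P}\frac{H(V)-H(C)}{|\mathcal P|-1}$. One has $R_{\mathrm{ACO}}(V)=\max_{\mathcal P\in\Pi'(V)}\varphi(\mathcal P)$, and the unique finest maximizer is the fundamental partition $\mathcal P^*$. For $\alpha\ge0$: $f^{\#}_\alpha(\emptyset)=0$, $f^{\#}_\alpha(X)=\alpha-H(V)+H(X)$ for $\emptyset\ne X\subseteq V$. For $C\subseteq V$, the reduction $f^{\#}_{\alpha,C}:2^C\to\mathbb R$ is $f^{\#}_{\alpha,C}(X)=f^{\#}_\alpha(X)$, $X\subseteq C$, and $\hat f^{\#}_{\alpha,C}(X)=\min_{\mathcal P\in\Pi(X)}\sum_{D\in\mathcal P}f^{\#}_{\alpha,C}(D)$ (value $0$ at $\emptyset$) is its Dilworth truncation. $B(\hat f^{\#}_{\alpha,C},\le)=\{\mathbf r_C\in\mathbb R^{|C|}: r(X)\le\hat f^{\#}_{\alpha,C}(X)\ \forall X\subseteq C,\ r(C)=\hat f^{\#}_{\alpha,C}(C)\}$. *)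

theory Defs
  imports "HOL-Probability.Probability"
begin

text \<open>
  A real vector indexed by a set \<open>X\<close> is represented by an element of \<open>extensional X\<close>,
  i.e. a function that is \<open>undefined\<close> outside \<open>X\<close>; the value \<open>r(Y)\<close> is \<open>sum r Y\<close>.
\<close>

subsection \<open>Entropy of a family of discrete random variables\<close>

text \<open>\<open>Z i\<close> takes values in the countable alphabet \<open>S i\<close>, and \<open>b\<close> is the base of the logarithm.\<close>

definition joint_alphabet :: "('i \<Rightarrow> 'z set) \<Rightarrow> 'i set \<Rightarrow> ('i \<Rightarrow> 'z) measure" where
  "joint_alphabet S X = count_space (PiE X S)"

definition joint_tuple :: "('i \<Rightarrow> 'm \<Rightarrow> 'z) \<Rightarrow> 'i set \<Rightarrow> 'm \<Rightarrow> 'i \<Rightarrow> 'z" where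
  "joint_tuple Z X = (\<lambda>\<omega>. \<lambda>i\<in>X. Z i \<omega>)"

definition joint_entropy ::
  "'m measure \<Rightarrow> real \<Rightarrow> ('i \<Rightarrow> 'z set) \<Rightarrow> ('i \<Rightarrow> 'm \<Rightarrow> 'z) \<Rightarrow> 'i set \<Rightarrow> real" where
  "joint_entropy M b S Z X = prob_space.entropy M b (joint_alphabet S X) (joint_tuple Z X)"

definition cond_H :: "('i set \<Rightarrow> real) \<Rightarrow> 'i set \<Rightarrow> 'i set \<Rightarrow> real" where
  "cond_H H X Y = H (X \<union> Y) - H Y"


subsection \<open>Communication for omniscience\<close>

definition R_CO_region :: "'i set \<Rightarrow> ('i set \<Rightarrow> real) \<Rightarrow> ('i \<Rightarrow> real) set" where
  "R_CO_region V H = {r \<in> extensional V. \<forall>X. X \<subset> V \<longrightarrow> sum r X \<ge> cond_H H X (V - X)}"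

definition R_ACO :: "'i set \<Rightarrow> ('i set \<Rightarrow> real) \<Rightarrow> real" where
  "R_ACO V H = (LEAST a. a \<in> (\<lambda>r. sum r V) ` R_CO_region V H)"

definition R_ACO_region :: "'i set \<Rightarrow> ('i set \<Rightarrow> real) \<Rightarrow> ('i \<Rightarrow> real) set" where
  "R_ACO_region V H = {r \<in> R_CO_region V H. sum r V = R_ACO V H}"


subsection \<open>The fundamental partition\<close>

definition nontrivial_partitions :: "'i set \<Rightarrow> 'i set set set" where
  "nontrivial_partitions V = {P. partition_on V P \<and> card P > 1}"

definition phi :: "'i set \<Rightarrow> ('i set \<Rightarrow> real) \<Rightarrow> 'i set set \<Rightarrow> real" where
  "phi V H P = (\<Sum>C\<in>P. (H V - H C) / (real (card P) - 1))"

definition phi_maximizer :: "'i set \<Rightarrow> ('i set \<Rightarrow> real) \<Rightarrow> 'i set set \<Rightarrow> bool" where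
  "phi_maximizer V H P \<longleftrightarrow> is_arg_max (phi V H) (\<lambda>Q. Q \<in> nontrivial_partitions V) P"

definition fundamental_partition :: "'i set \<Rightarrow> ('i set \<Rightarrow> real) \<Rightarrow> 'i set set \<Rightarrow> bool" where
  "fundamental_partition V H P \<longleftrightarrow>
     phi_maximizer V H P \<and> (\<forall>Q. phi_maximizer V H Q \<longrightarrow> refines V P Q)"


subsection \<open>Dilworth truncation and base polyhedra\<close>

definition f_sharp :: "'i set \<Rightarrow> ('i set \<Rightarrow> real) \<Rightarrow> real \<Rightarrow> 'i set \<Rightarrow> real" where
  "f_sharp V H \<alpha> X = (if X = {} then 0 else \<alpha> - H V + H X)"

definition reduction :: "'i set \<Rightarrow> ('i set \<Rightarrow> real) \<Rightarrow> 'i set \<Rightarrow> real" where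
  "reduction C f = restrict f (Pow C)"

definition dilworth_truncation :: "('i set \<Rightarrow> real) \<Rightarrow> 'i set \<Rightarrow> real" where
  "dilworth_truncation f X = Min ((\<lambda>P. \<Sum>D\<in>P. f D) ` {P. partition_on X P})"

definition base_polyhedron :: "'i set \<Rightarrow> ('i set \<Rightarrow> real) \<Rightarrow> ('i \<Rightarrow> real) set" where
  "base_polyhedron C f = {r \<in> extensional C. (\<forall>X\<subseteq>C. sum r X \<le> f X) \<and> sum r C = f C}"


subsection \<open>Separable functions and concatenation\<close>

definition separable :: "('i \<Rightarrow> real \<Rightarrow> real) \<Rightarrow> 'i set \<Rightarrow> ('i \<Rightarrow> real) \<Rightarrow> real" where
  "separable g X r = (\<Sum>i\<in>X. g i (r i))"

text \<open>Direct sum over the blocks of a partition \<open>P\<close> of vectors \<open>r C\<close> indexed by the block \<open>C\<close>.\<close>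

definition concat_vectors :: "'i set set \<Rightarrow> ('i set \<Rightarrow> 'i \<Rightarrow> real) \<Rightarrow> 'i \<Rightarrow> real" where
  "concat_vectors P r = (\<lambda>i\<in>\<Union>P. r (THE C. C \<in> P \<and> i \<in> C) i)"

end

theory Submission
  imports Defs
begin

text \<open>
  Put \<open>f = f_sharp V H R\<close> with \<open>R = R_ACO V H\<close>. Entropy is submodular, so \<open>f\<close> is
  intersecting submodular. The maximal tight sets of a maximal vector dominated by \<open>f\<close> partition
  \<open>V\<close>, which gives \<open>R = max phi\<close>; equivalently \<open>f V \<le> (\<Sum>D\<in>Q. f D)\<close> for every partition
  \<open>Q\<close>, with equality for the fundamental partition \<open>P\<close>. Hence every optimal rate vector is
  tight on each block of \<open>P\<close>. Conversely, minimality of \<open>P\<close> makes \<open>f\<close> agree with its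
  Dilworth truncation on each block, and uncrossing an arbitrary set with the blocks it meets shows
  that vectors dominated on every block concatenate to a vector dominated on \<open>V\<close>. So the optimal
  region is the direct sum of the base polyhedra of the blocks, and a separable function is
  minimised blockwise.
\<close>

subsection \<open>Submodularity of entropy\<close>

text \<open>Passes from the extended nonnegative integral, where sums and integrals may be exchanged
  freely, to the Bochner integral in which entropies are expressed.\<close>

lemma integrable_nonneg_bound:
  fixes f :: "'a \<Rightarrow> real"
  assumes "f \<in> borel_measurable M" and "\<And>x. x \<in> space M \<Longrightarrow> 0 \<le> f x"
    and "(\<integral>\<^sup>+x. ennreal (f x) \<partial>M) \<le> ennreal c" and "0 \<le> c"
  shows "integrable M f" and "integral\<^sup>L M f \<le> c"
proof -
  have "(\<integral>\<^sup>+x. ennreal (f x) \<partial>M) < \<infinity>"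
    using assms(3) by (simp add: order_le_less_trans)
  then show "integrable M f"
    using assms(1,2) by (intro integrableI_nonneg) auto
  then have "(\<integral>\<^sup>+x. ennreal (f x) \<partial>M) = ennreal (integral\<^sup>L M f)"
    using assms(2) by (intro nn_integral_eq_integral) auto
  then show "integral\<^sup>L M f \<le> c"
    using assms(3,4) by simp
qed

lemma nn_integral_count_space_indicator_le_1:
  assumes "\<And>a a'. a \<in> A \<Longrightarrow> Q a \<Longrightarrow> a' \<in> A \<Longrightarrow> Q a' \<Longrightarrow> a = a'"
  shows "(\<integral>\<^sup>+a. indicator {a. Q a} a \<partial>count_space A) \<le> 1"
proof (cases "\<exists>a\<in>A. Q a")
  case True
  then obtain a where "a \<in> A" "Q a" by blast
  then have "(\<integral>\<^sup>+a. indicator {a. Q a} a \<partial>count_space A) =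
      (\<Sum>a\<in>{a}. (indicator {a. Q a} a :: ennreal))"
  proof (intro nn_integral_count_space')
    fix a' assume "a' \<in> A" "a' \<notin> {a}"
    then have "\<not> Q a'" using assms \<open>a \<in> A\<close> \<open>Q a\<close> by blast
    then show "(indicator {a. Q a} a' :: ennreal) = 0" by simp
  qed (use \<open>a \<in> A\<close> in auto)
  then show ?thesis using \<open>Q a\<close> by simp
next
  case False
  then have "(\<integral>\<^sup>+a. indicator {a. Q a} a \<partial>count_space A) = (\<integral>\<^sup>+a. 0 \<partial>count_space A)"
    by (intro nn_integral_cong) auto
  then show ?thesis by simp
qed

lemma distributed_count_space_point:
  assumes "distributed M (count_space A) X p" and "a \<in> A"
  shows "p a = emeasure M (X -` {a} \<inter> space M)"
proof -
  have "emeasure M (X -` {a} \<inter> space M) = (\<integral>\<^sup>+x. p x * indicator {a} x \<partial>count_space A)"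
    using assms by (intro distributed_emeasure) auto
  also have "\<dots> = p a"
    using assms(2) by (subst nn_integral_count_space'[of "{a}"]) auto
  finally show ?thesis by simp
qed

text \<open>The values of nonpositive density carry probability equal to the integral of the density
  over them, and that integral is 0. This makes logarithms of densities split into sums almost
  surely.\<close>

lemma AE_distributed_count_space_pos:
  fixes p :: "'b \<Rightarrow> real"
  assumes "distributed M (count_space A) X p"
  shows "AE \<omega> in M. 0 < p (X \<omega>)"
proof -
  have X: "X \<in> measurable M (count_space A)"
    using distributed_measurable[OF assms] .
  let ?B = "{a \<in> A. p a \<le> 0}"
  have "emeasure M (X -` ?B \<inter> space M) = (\<integral>\<^sup>+x. ennreal (p x) * indicator ?B x \<partial>count_space A)"
    using assms by (intro distributed_emeasure) auto
  also have "\<dots> = (\<integral>\<^sup>+x. 0 \<partial>count_space A)"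
    by (intro nn_integral_cong) (auto simp: indicator_def ennreal_neg)
  finally have "emeasure M (X -` ?B \<inter> space M) = 0" by simp
  moreover have "X -` ?B \<inter> space M \<in> sets M"
    using X by (rule measurable_sets) auto
  ultimately have "X -` ?B \<inter> space M \<in> null_sets M" by auto
  moreover have "{\<omega> \<in> space M. \<not> 0 < p (X \<omega>)} \<subseteq> X -` ?B \<inter> space M"
    using measurable_space[OF X] by (auto simp: not_less)
  ultimately show ?thesis by (rule AE_I')
qed

context information_space
begin

text \<open>As expectations over the common space \<open>M\<close>, the entropies of tuples over
  different index sets can be compared under a single integral.\<close>

lemma finite_entropy_eq_expectation:
  assumes "finite_entropy (count_space A) X p"
  shows "entropy b (count_space A) X = - (\<integral>\<omega>. log b (p (X \<omega>)) \<partial>M)"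
    and "integrable M (\<lambda>\<omega>. log b (p (X \<omega>)))"
proof -
  have D: "distributed M (count_space A) X p" and nn: "\<And>x. x \<in> A \<Longrightarrow> 0 \<le> p x"
    and I: "integrable (count_space A) (\<lambda>x. p x * log b (p x))"
    using assms by (auto simp: finite_entropy_def)
  show "entropy b (count_space A) X = - (\<integral>\<omega>. log b (p (X \<omega>)) \<partial>M)"
    using entropy_distr[OF D] distributed_integral[OF D, of "\<lambda>x. log b (p x)"] nn by simp
  show "integrable M (\<lambda>\<omega>. log b (p (X \<omega>)))"
    using distributed_integrable[OF D, of "\<lambda>x. log b (p x)"] nn I by simp
qed

text \<open>Each summand is the probability that the \<open>Y\<close>-tuple equals
  \<open>restrict a Y\<close>. For distinct extensions \<open>a\<close> of \<open>x\<close> these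
  events are disjoint, and all lie in the event that the tuple over \<open>X \<inter> Y\<close>
  agrees with \<open>x\<close>.\<close>

lemma joint_fibre_bound:
  fixes X Y :: "'i set" and pY pI :: "('i \<Rightarrow> 'z) \<Rightarrow> real"
  assumes ct: "countable (PiE (X \<union> Y) S)"
    and DY: "distributed M (count_space (PiE Y S)) (joint_tuple Z Y) pY"
    and DI: "distributed M (count_space (PiE (X \<inter> Y) S)) (joint_tuple Z (X \<inter> Y)) pI"
    and x: "x \<in> PiE X S"
  shows "(\<integral>\<^sup>+a. indicator {a. restrict a X = x} a * ennreal (pY (restrict a Y))
            \<partial>count_space (PiE (X \<union> Y) S)) \<le> ennreal (pI (restrict x (X \<inter> Y)))"
proof -
  let ?U = "PiE (X \<union> Y) S"
  let ?Q = "\<lambda>\<omega> a. restrict a X = x \<and> joint_tuple Z Y \<omega> = restrict a Y"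
  have MY[measurable]: "joint_tuple Z Y \<in> measurable M (count_space (PiE Y S))"
    using distributed_measurable[OF DY] .
  have MI[measurable]: "joint_tuple Z (X \<inter> Y) \<in> measurable M (count_space (PiE (X \<inter> Y) S))"
    using distributed_measurable[OF DI] .
  let ?F = "\<lambda>a. {\<omega> \<in> space M. ?Q \<omega> a}"
  have F: "?F a \<in> sets M" if "a \<in> ?U" for a
  proof -
    \<comment> \<open>The condition on \<open>a\<close> does not involve \<omega>, so the event is
      empty or an event about the \<open>Y\<close>-tuple alone.\<close>
    have "?F a = (if restrict a X = x then joint_tuple Z Y -` {restrict a Y} \<inter> space M else {})"
      by auto
    moreover have "joint_tuple Z Y -` {restrict a Y} \<inter> space M \<in> sets M"
      using that by (intro measurable_sets[OF MY]) (auto simp: PiE_def)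
    ultimately show ?thesis by simp
  qed
  let ?G = "joint_tuple Z (X \<inter> Y) -` {restrict x (X \<inter> Y)} \<inter> space M"
  have rx: "restrict x (X \<inter> Y) \<in> PiE (X \<inter> Y) S" using x by auto
  then have G: "?G \<in> sets M" by (intro measurable_sets[OF MI]) auto
  have "(\<integral>\<^sup>+a. indicator {a. restrict a X = x} a * ennreal (pY (restrict a Y)) \<partial>count_space ?U)
      = (\<integral>\<^sup>+a. \<integral>\<^sup>+\<omega>. indicator (?F a) \<omega> \<partial>M \<partial>count_space ?U)"
  proof (intro nn_integral_cong)
    fix a assume "a \<in> space (count_space ?U)"
    then have a: "a \<in> ?U" by simp
    then have "restrict a Y \<in> PiE Y S" by auto
    then have "ennreal (pY (restrict a Y)) = emeasure M (joint_tuple Z Y -` {restrict a Y} \<inter> space M)"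
      by (rule distributed_count_space_point[OF DY])
    moreover have "?F a = (if restrict a X = x then joint_tuple Z Y -` {restrict a Y} \<inter> space M else {})"
      by auto
    ultimately show "indicator {a. restrict a X = x} a * ennreal (pY (restrict a Y)) =
        (\<integral>\<^sup>+\<omega>. indicator (?F a) \<omega> \<partial>M)"
      using nn_integral_indicator[OF F[OF a]] by simp
  qed
  also have "\<dots> = (\<integral>\<^sup>+\<omega>. \<integral>\<^sup>+a. indicator (?F a) \<omega> \<partial>count_space ?U \<partial>M)"
    using F by (intro nn_integral_count_space_nn_integral[symmetric] ct) auto
  \<comment> \<open>For a fixed \<omega> at most one \<open>a\<close> counts, since its restrictions
    to \<open>X\<close> and \<open>Y\<close> determine it, and none counts outside
    \<open>?G\<close>.\<close>
  also have "\<dots> \<le> (\<integral>\<^sup>+\<omega>. indicator ?G \<omega> \<partial>M)"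
  proof (intro nn_integral_mono)
    fix \<omega> assume w: "\<omega> \<in> space M"
    have eq: "(\<integral>\<^sup>+a. indicator (?F a) \<omega> \<partial>count_space ?U) =
        (\<integral>\<^sup>+a. indicator {a. ?Q \<omega> a} a \<partial>count_space ?U)"
      using w by (intro nn_integral_cong) (auto simp: indicator_def)
    show "(\<integral>\<^sup>+a. indicator (?F a) \<omega> \<partial>count_space ?U) \<le> indicator ?G \<omega>"
    proof (cases "\<omega> \<in> ?G")
      case True
      have "(\<integral>\<^sup>+a. indicator {a. ?Q \<omega> a} a \<partial>count_space ?U) \<le> 1"
      proof (rule nn_integral_count_space_indicator_le_1)
        fix a a' assume "a \<in> ?U" "?Q \<omega> a" "a' \<in> ?U" "?Q \<omega> a'"
        then have X: "restrict a X = restrict a' X" and Y: "restrict a Y = restrict a' Y" by auto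
        show "a = a'"
        proof (rule PiE_ext[OF \<open>a \<in> ?U\<close> \<open>a' \<in> ?U\<close>])
          fix i assume "i \<in> X \<union> Y"
          then show "a i = a' i" using fun_cong[OF X, of i] fun_cong[OF Y, of i] by auto
        qed
      qed
      then show ?thesis using True eq by simp
    next
      case False
      have "\<not> ?Q \<omega> a" for a
      proof
        assume Q: "?Q \<omega> a"
        have "joint_tuple Z (X \<inter> Y) \<omega> = restrict (joint_tuple Z Y \<omega>) (X \<inter> Y)"
          by (auto simp: joint_tuple_def)
        also have "\<dots> = restrict (restrict a Y) (X \<inter> Y)" using Q by simp
        also have "\<dots> = restrict (restrict a X) (X \<inter> Y)" by (auto simp: fun_eq_iff)
        also have "\<dots> = restrict x (X \<inter> Y)" using Q by simp
        finally show False using False w by simp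
      qed
      then show ?thesis using eq by simp
    qed
  qed
  also have "\<dots> = ennreal (pI (restrict x (X \<inter> Y)))"
    using G distributed_count_space_point[OF DI rx] by simp
  finally show ?thesis .
qed

text \<open>
  Only the places where the denominator is nonzero contribute to the expectation, since
  division by \<open>0\<close> gives \<open>0\<close>; this is why the bound is an inequality.
\<close>

lemma expectation_density_ratio_le_1:
  fixes X Y :: "'i set" and pX pY pU pI :: "('i \<Rightarrow> 'z) \<Rightarrow> real"
  assumes ct: "countable (PiE (X \<union> Y) S)" "countable (PiE X S)"
    and DX: "distributed M (count_space (PiE X S)) (joint_tuple Z X) pX"
    and DY: "distributed M (count_space (PiE Y S)) (joint_tuple Z Y) pY"
    and DU: "distributed M (count_space (PiE (X \<union> Y) S)) (joint_tuple Z (X \<union> Y)) pU"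
    and DI: "distributed M (count_space (PiE (X \<inter> Y) S)) (joint_tuple Z (X \<inter> Y)) pI"
    and nn: "\<And>x. x \<in> PiE X S \<Longrightarrow> 0 \<le> pX x" "\<And>x. x \<in> PiE Y S \<Longrightarrow> 0 \<le> pY x"
      "\<And>x. x \<in> PiE (X \<union> Y) S \<Longrightarrow> 0 \<le> pU x" "\<And>x. x \<in> PiE (X \<inter> Y) S \<Longrightarrow> 0 \<le> pI x"
  shows "(\<integral>\<^sup>+\<omega>. ennreal (pX (joint_tuple Z X \<omega>) * pY (joint_tuple Z Y \<omega>) /
      (pU (joint_tuple Z (X \<union> Y) \<omega>) * pI (joint_tuple Z (X \<inter> Y) \<omega>))) \<partial>M) \<le> 1"
proof -
  let ?U = "PiE (X \<union> Y) S"
  let ?h = "\<lambda>a. pX (restrict a X) * pY (restrict a Y) / (pU a * pI (restrict a (X \<inter> Y)))"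
  let ?k = "\<lambda>x. ennreal (pX x / pI (restrict x (X \<inter> Y)))"
  have tup: "joint_tuple Z X \<omega> = restrict (joint_tuple Z (X \<union> Y) \<omega>) X"
    "joint_tuple Z Y \<omega> = restrict (joint_tuple Z (X \<union> Y) \<omega>) Y"
    "joint_tuple Z (X \<inter> Y) \<omega> = restrict (joint_tuple Z (X \<union> Y) \<omega>) (X \<inter> Y)" for \<omega>
    by (auto simp: joint_tuple_def)
  have "(\<integral>\<^sup>+\<omega>. ennreal (pX (joint_tuple Z X \<omega>) * pY (joint_tuple Z Y \<omega>) /
      (pU (joint_tuple Z (X \<union> Y) \<omega>) * pI (joint_tuple Z (X \<inter> Y) \<omega>))) \<partial>M)
      = (\<integral>\<^sup>+\<omega>. ennreal (?h (joint_tuple Z (X \<union> Y) \<omega>)) \<partial>M)"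
    by (simp only: tup)
  also have "\<dots> = (\<integral>\<^sup>+a. ennreal (pU a) * ennreal (?h a) \<partial>count_space ?U)"
    by (rule distributed_nn_integral[OF DU, symmetric]) simp
  \<comment> \<open>Cancels \<open>pU a\<close> and inserts a sum over \<open>x\<close> whose only
    nonzero term is \<open>x = restrict a X\<close>, so that the sum over \<open>a\<close> can be
    carried out first, fibre by fibre.\<close>
  also have "\<dots> \<le> (\<integral>\<^sup>+a. \<integral>\<^sup>+x. indicator {a. restrict a X = x} a *
      (?k x * ennreal (pY (restrict a Y))) \<partial>count_space (PiE X S) \<partial>count_space ?U)"
  proof (intro nn_integral_mono)
    fix a assume "a \<in> space (count_space ?U)"
    then have a: "a \<in> ?U" by simp
    then have aX: "restrict a X \<in> PiE X S" and aY: "restrict a Y \<in> PiE Y S"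
      and aI: "restrict a (X \<inter> Y) \<in> PiE (X \<inter> Y) S" by auto
    have rr: "restrict (restrict a X) (X \<inter> Y) = restrict a (X \<inter> Y)" by (auto simp: fun_eq_iff)
    have "ennreal (pU a) * ennreal (?h a) = ennreal (pU a * ?h a)"
      using ennreal_mult'[OF nn(3)[OF a], of "?h a"] by (rule sym)
    also have "\<dots> \<le> ennreal (pX (restrict a X) / pI (restrict a (X \<inter> Y)) * pY (restrict a Y))"
      using nn(1)[OF aX] nn(2)[OF aY] nn(3)[OF a] nn(4)[OF aI]
      by (intro ennreal_leI) (cases "pU a = 0"; simp)
    also have "\<dots> = ?k (restrict a X) * ennreal (pY (restrict a Y))"
      unfolding rr by (rule ennreal_mult''[OF nn(2)[OF aY]])
    also have "\<dots> = (\<Sum>x\<in>{restrict a X}. indicator {a. restrict a X = x} a *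
        (?k x * ennreal (pY (restrict a Y))))"
      by simp
    also have "\<dots> = (\<integral>\<^sup>+x. indicator {a. restrict a X = x} a *
        (?k x * ennreal (pY (restrict a Y))) \<partial>count_space (PiE X S))"
      using aX by (intro nn_integral_count_space'[symmetric]) auto
    finally show "ennreal (pU a) * ennreal (?h a) \<le> \<dots>" .
  qed
  also have "\<dots> = (\<integral>\<^sup>+x. \<integral>\<^sup>+a. indicator {a. restrict a X = x} a *
      (?k x * ennreal (pY (restrict a Y))) \<partial>count_space ?U \<partial>count_space (PiE X S))"
    by (intro nn_integral_count_space_nn_integral ct) auto
  also have "\<dots> = (\<integral>\<^sup>+x. ?k x * (\<integral>\<^sup>+a. indicator {a. restrict a X = x} a *
      ennreal (pY (restrict a Y)) \<partial>count_space ?U) \<partial>count_space (PiE X S))"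
    by (subst nn_integral_cmult[symmetric]) (auto simp: mult_ac)
  \<comment> \<open>The fibre sum supplies the factor that cancels the denominator in
    \<open>?k\<close>, leaving the total mass of \<open>pX\<close>.\<close>
  also have "\<dots> \<le> (\<integral>\<^sup>+x. ?k x * ennreal (pI (restrict x (X \<inter> Y))) \<partial>count_space (PiE X S))"
    by (intro nn_integral_mono mult_left_mono joint_fibre_bound[OF ct(1) DY DI]) auto
  also have "\<dots> \<le> (\<integral>\<^sup>+x. ennreal (pX x) * 1 \<partial>count_space (PiE X S))"
  proof (intro nn_integral_mono)
    fix x assume "x \<in> space (count_space (PiE X S))"
    then have x: "x \<in> PiE X S" by simp
    then have "restrict x (X \<inter> Y) \<in> PiE (X \<inter> Y) S" by auto
    note nI = nn(4)[OF this]
    have "?k x * ennreal (pI (restrict x (X \<inter> Y)))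
        = ennreal (pX x / pI (restrict x (X \<inter> Y)) * pI (restrict x (X \<inter> Y)))"
      by (rule ennreal_mult''[OF nI, symmetric])
    also have "\<dots> \<le> ennreal (pX x)"
      using nn(1)[OF x] by (intro ennreal_leI) (cases "pI (restrict x (X \<inter> Y)) = 0"; simp)
    finally show "?k x * ennreal (pI (restrict x (X \<inter> Y))) \<le> ennreal (pX x) * 1" by simp
  qed
  also have "\<dots> = (\<integral>\<^sup>+\<omega>. 1 \<partial>M)"
    by (rule distributed_nn_integral[OF DX]) simp
  also have "\<dots> = 1" by (simp add: emeasure_space_1)
  finally show ?thesis .
qed

text \<open>The right side minus the left is the conditional mutual information of \<open>X\<close>
  and \<open>Y\<close> given \<open>X \<inter> Y\<close>. Its negative is the expected logarithm of
  a density ratio \<open>t\<close>; by \<open>ln t \<le> t - 1\<close> and the bound 1 on the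
  expectation of \<open>t\<close>, it is at most 0.\<close>

lemma joint_entropy_submodular:
  fixes V :: "'i set" and S :: "'i \<Rightarrow> 'z set"
  assumes "finite V" and S: "\<And>i. i \<in> V \<Longrightarrow> countable (S i)"
    and fin: "\<And>X. X \<subseteq> V \<Longrightarrow> \<exists>p. finite_entropy (joint_alphabet S X) (joint_tuple Z X) p"
    and "X \<subseteq> V" "Y \<subseteq> V"
  shows "joint_entropy M b S Z (X \<union> Y) + joint_entropy M b S Z (X \<inter> Y)
      \<le> joint_entropy M b S Z X + joint_entropy M b S Z Y"
proof -
  have ct: "countable (PiE W S)" if "W \<subseteq> V" for W
    using that \<open>finite V\<close> S by (intro countable_PiE) (auto intro: finite_subset)
  obtain p where p: "\<And>W. W \<subseteq> V \<Longrightarrow> finite_entropy (count_space (PiE W S)) (joint_tuple Z W) (p W)"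
    using fin unfolding joint_alphabet_def by metis
  have sub: "X \<union> Y \<subseteq> V" "X \<inter> Y \<subseteq> V" using assms by auto
  let ?l = "\<lambda>W \<omega>. log b (p W (joint_tuple Z W \<omega>))"
  have H: "joint_entropy M b S Z W = - (\<integral>\<omega>. ?l W \<omega> \<partial>M)" and int: "integrable M (?l W)"
    and D: "distributed M (count_space (PiE W S)) (joint_tuple Z W) (p W)"
    and nn: "\<And>x. x \<in> PiE W S \<Longrightarrow> 0 \<le> p W x" if "W \<subseteq> V" for W
    using finite_entropy_eq_expectation[OF p[OF that]] p[OF that]
    by (auto simp: joint_entropy_def joint_alphabet_def finite_entropy_def)
  let ?t = "\<lambda>\<omega>. p X (joint_tuple Z X \<omega>) * p Y (joint_tuple Z Y \<omega>) /
      (p (X \<union> Y) (joint_tuple Z (X \<union> Y) \<omega>) * p (X \<inter> Y) (joint_tuple Z (X \<inter> Y) \<omega>))"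
  have pm: "(\<lambda>\<omega>. p W (joint_tuple Z W \<omega>)) \<in> borel_measurable M" if "W \<subseteq> V" for W
    using distributed_measurable[OF D[OF that]] by (rule measurable_compose) simp
  have nn': "0 \<le> p W (joint_tuple Z W \<omega>)" if "W \<subseteq> V" "\<omega> \<in> space M" for W \<omega>
    using measurable_space[OF distributed_measurable[OF D[OF that(1)]] that(2)] nn[OF that(1)] by simp
  have tm: "?t \<in> borel_measurable M"
    using pm[OF \<open>X \<subseteq> V\<close>] pm[OF \<open>Y \<subseteq> V\<close>] pm[OF sub(1)] pm[OF sub(2)] by measurable
  have tn: "0 \<le> ?t \<omega>" if "\<omega> \<in> space M" for \<omega>
    using nn'[OF \<open>X \<subseteq> V\<close> that] nn'[OF \<open>Y \<subseteq> V\<close> that] nn'[OF sub(1) that] nn'[OF sub(2) that] by simp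
  have t1: "(\<integral>\<^sup>+\<omega>. ennreal (?t \<omega>) \<partial>M) \<le> ennreal 1"
    using expectation_density_ratio_le_1[OF ct[OF sub(1)] ct[OF \<open>X \<subseteq> V\<close>] D[OF \<open>X \<subseteq> V\<close>]
        D[OF \<open>Y \<subseteq> V\<close>] D[OF sub(1)] D[OF sub(2)] nn[OF \<open>X \<subseteq> V\<close>] nn[OF \<open>Y \<subseteq> V\<close>] nn[OF sub(1)] nn[OF sub(2)]]
    by simp
  note t = integrable_nonneg_bound[OF tm tn t1]
  have lb: "0 < ln b" using b_gt_1 by simp
  let ?L = "\<lambda>\<omega>. ?l X \<omega> + ?l Y \<omega> - ?l (X \<union> Y) \<omega> - ?l (X \<inter> Y) \<omega>"
  note i = int[OF \<open>X \<subseteq> V\<close>] int[OF \<open>Y \<subseteq> V\<close>] int[OF sub(1)] int[OF sub(2)]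
  have "(\<integral>\<omega>. ?L \<omega> \<partial>M) \<le> (\<integral>\<omega>. (?t \<omega> - 1) / ln b \<partial>M)"
  proof (rule integral_mono_AE)
    show "integrable M ?L" using i by simp
    show "integrable M (\<lambda>\<omega>. (?t \<omega> - 1) / ln b)" using t(1) by simp
    \<comment> \<open>Almost surely all four densities are positive, so the four logarithms combine
      into that of the ratio.\<close>
    show "AE \<omega> in M. ?L \<omega> \<le> (?t \<omega> - 1) / ln b"
      using AE_distributed_count_space_pos[OF D[OF \<open>X \<subseteq> V\<close>]] AE_distributed_count_space_pos[OF D[OF \<open>Y \<subseteq> V\<close>]]
        AE_distributed_count_space_pos[OF D[OF sub(1)]] AE_distributed_count_space_pos[OF D[OF sub(2)]]
    proof eventually_elim
      case (elim \<omega>)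
      then have "?L \<omega> = ln (?t \<omega>) / ln b"
        by (simp add: log_def ln_mult ln_div diff_divide_distrib add_divide_distrib)
      also have "\<dots> \<le> (?t \<omega> - 1) / ln b"
        using elim lb by (intro divide_right_mono ln_le_minus_one) auto
      finally show ?case .
    qed
  qed
  also have "\<dots> = ((\<integral>\<omega>. ?t \<omega> \<partial>M) - 1) / ln b"
    using t(1) by (simp add: prob_space)
  also have "\<dots> \<le> 0" using t(2) lb by (simp add: divide_nonpos_pos)
  finally show ?thesis
    using i H[OF \<open>X \<subseteq> V\<close>] H[OF \<open>Y \<subseteq> V\<close>] H[OF sub(1)] H[OF sub(2)] by simp
qed

end

subsection \<open>Vectors dominated by an intersecting submodular function\<close>

lemma sum_partition_on:
  fixes r :: "'i \<Rightarrow> 'b::comm_monoid_add"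
  assumes "finite V" and "partition_on V Q"
  shows "(\<Sum>C\<in>Q. sum r C) = sum r V"
proof -
  have "\<forall>C\<in>Q. finite C"
    using assms by (metis Sup_upper finite_subset partition_onD1)
  then show ?thesis
    using sum.Union_disjoint[of Q r] partition_onD1[OF assms(2)] partition_onD2[OF assms(2)]
    by (simp add: disjoint_def)
qed

text \<open>Disjoint pairs are left out because \<open>f_sharp\<close> is reset to 0 at the empty
  set, which can break the inequality for them.\<close>

definition intersecting_submodular :: "'i set \<Rightarrow> ('i set \<Rightarrow> real) \<Rightarrow> bool" where
  "intersecting_submodular V f \<longleftrightarrow>
     (\<forall>X\<subseteq>V. \<forall>Y\<subseteq>V. X \<inter> Y \<noteq> {} \<longrightarrow> f (X \<union> Y) + f (X \<inter> Y) \<le> f X + f Y)"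

definition dominated :: "'i set \<Rightarrow> ('i set \<Rightarrow> real) \<Rightarrow> ('i \<Rightarrow> real) \<Rightarrow> bool" where
  "dominated V f r \<longleftrightarrow> (\<forall>X\<subseteq>V. X \<noteq> {} \<longrightarrow> sum r X \<le> f X)"

text \<open>A constant vector works whose entries are minus a bound on all values of
  \<open>\<bar>f X\<bar>\<close>: a nonempty set has sum at most one such entry.\<close>

lemma exists_dominated:
  assumes "finite V"
  shows "\<exists>r. dominated V f r"
proof -
  let ?m = "Max ((\<lambda>X. \<bar>f X\<bar>) ` Pow V)"
  have m: "\<bar>f X\<bar> \<le> ?m" if "X \<subseteq> V" for X
    using assms that by (intro Max_ge) auto
  have m0: "0 \<le> ?m" using m[of "{}"] by simp
  have "sum (\<lambda>_. - ?m) X \<le> f X" if "X \<subseteq> V" "X \<noteq> {}" for X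
  proof -
    have "finite X" using that assms finite_subset by blast
    then have "1 \<le> real (card X)" using that by (simp add: Suc_le_eq card_gt_0_iff)
    then have "?m \<le> real (card X) * ?m" using m0 by (simp add: mult_le_cancel_right1)
    then show ?thesis using m[OF that(1)] by simp
  qed
  then show ?thesis unfolding dominated_def by blast
qed

definition tight_set :: "'i set \<Rightarrow> ('i set \<Rightarrow> real) \<Rightarrow> ('i \<Rightarrow> real) \<Rightarrow> 'i set \<Rightarrow> bool" where
  "tight_set V f r X \<longleftrightarrow> X \<subseteq> V \<and> X \<noteq> {} \<and> sum r X = f X"

text \<open>
  Raising one coordinate after the other as far as domination allows: the coordinate raised last
  lies in a tight set, and earlier tight sets survive, because a tight set containing the new
  coordinate leaves no room for raising it.
\<close>

lemma exists_dominated_tight: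
  assumes "finite V"
  shows "\<exists>r. dominated V f r \<and> (\<forall>i\<in>V. \<exists>X. i \<in> X \<and> tight_set V f r X)"
proof -
  have "\<exists>r. dominated V f r \<and> (\<forall>i\<in>T. \<exists>X. i \<in> X \<and> tight_set V f r X)" if "T \<subseteq> V" for T
    using finite_subset[OF that assms] that
  proof (induction T rule: finite_induct)
    case empty
    then show ?case using exists_dominated[OF assms] by simp
  next
    case (insert i T)
    then obtain r where r: "dominated V f r" "\<And>j. j \<in> T \<Longrightarrow> \<exists>X. j \<in> X \<and> tight_set V f r X"
      by auto
    let ?A = "{X. X \<subseteq> V \<and> i \<in> X}"
    have A: "finite ?A" "?A \<noteq> {}" using assms insert.prems by auto
    \<comment> \<open>\<open>d\<close> is the least slack among the sets containing
      \<open>i\<close>, hence the largest admissible increase of that coordinate; \<open>X\<close>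
      attains it and becomes tight.\<close>
    obtain d X where X: "X \<in> ?A" "d = f X - sum r X"
      and d: "\<And>Y. Y \<subseteq> V \<Longrightarrow> i \<in> Y \<Longrightarrow> d \<le> f Y - sum r Y"
    proof -
      let ?S = "(\<lambda>X. f X - sum r X) ` ?A"
      have S: "finite ?S" "?S \<noteq> {}" using A by blast+
      obtain X where "X \<in> ?A" "Min ?S = f X - sum r X" using Min_in[OF S] by blast
      moreover have "Min ?S \<le> f Y - sum r Y" if "Y \<subseteq> V" "i \<in> Y" for Y
        using S(1) that by (intro Min_le) blast+
      ultimately show ?thesis by (rule that)
    qed
    have d0: "0 \<le> d" using X r(1) by (auto simp: dominated_def)
    let ?r = "r(i := r i + d)"
    have fin: "finite Y" if "Y \<subseteq> V" for Y using that assms finite_subset by blast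
    have s_in: "sum ?r Y = sum r Y + d" if "Y \<subseteq> V" "i \<in> Y" for Y
    proof -
      have "sum ?r Y = ?r i + sum ?r (Y - {i})" "sum r Y = r i + sum r (Y - {i})"
        using fin[OF that(1)] that(2) by (simp_all only: sum.remove)
      moreover have "sum ?r (Y - {i}) = sum r (Y - {i})" by (intro sum.cong) auto
      ultimately show ?thesis by simp
    qed
    have s_out: "sum ?r Y = sum r Y" if "i \<notin> Y" for Y
      using that by (intro sum.cong) auto
    have "dominated V f ?r"
      unfolding dominated_def
    proof (intro allI impI)
      fix Y assume Y: "Y \<subseteq> V" "Y \<noteq> {}"
      show "sum ?r Y \<le> f Y"
      proof (cases "i \<in> Y")
        case True
        then show ?thesis using s_in[OF Y(1)] d[OF Y(1)] by linarith
      next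
        case False
        then show ?thesis using s_out r(1) Y by (simp add: dominated_def)
      qed
    qed
    moreover have "\<exists>Y. j \<in> Y \<and> tight_set V f ?r Y" if "j \<in> insert i T" for j
    proof (cases "j = i")
      case True
      have "tight_set V f ?r X" using X s_in[of X] by (auto simp: tight_set_def)
      then show ?thesis using True X by blast
    next
      case False
      then have "j \<in> T" using that by simp
      then obtain Y where Y: "j \<in> Y" "tight_set V f r Y" using r(2) by blast
      then have YV: "Y \<subseteq> V" and Yf: "sum r Y = f Y" by (auto simp: tight_set_def)
      have "sum ?r Y = f Y"
      proof (cases "i \<in> Y")
        case True
        then have "d = 0" using d[OF YV True] d0 Yf by linarith
        then show ?thesis using s_in[OF YV True] Yf by linarith
      next
        case False
        then show ?thesis using s_out[OF False] Yf by simp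
      qed
      then have "tight_set V f ?r Y" using Y(2) by (simp add: tight_set_def del: fun_upd_apply)
      then show ?thesis using Y by blast
    qed
    ultimately show ?case by blast
  qed
  then show ?thesis by blast
qed

text \<open>The slack \<open>f - sum r\<close> is nonnegative on nonempty sets and submodular on
  intersecting pairs. Being 0 at \<open>X\<close> and \<open>Y\<close>, it must be 0 at their union
  and intersection.\<close>

lemma tight_set_Un:
  assumes "finite V" and sub: "intersecting_submodular V f" and dom: "dominated V f r"
    and X: "tight_set V f r X" and Y: "tight_set V f r Y" and ne: "X \<inter> Y \<noteq> {}"
  shows "tight_set V f r (X \<union> Y)"
proof -
  have XY: "X \<subseteq> V" "Y \<subseteq> V" "X \<noteq> {}" using X Y by (auto simp: tight_set_def)
  have fin: "finite X" "finite Y" using XY assms(1) finite_subset by blast+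
  have "f (X \<union> Y) + f (X \<inter> Y) \<le> f X + f Y"
    using sub XY ne by (simp add: intersecting_submodular_def)
  moreover have "sum r (X \<union> Y) + sum r (X \<inter> Y) = f X + f Y"
    using sum.union_inter[OF fin, of r] X Y by (simp add: tight_set_def)
  moreover have "sum r (X \<union> Y) \<le> f (X \<union> Y)" "sum r (X \<inter> Y) \<le> f (X \<inter> Y)"
    using dom XY ne Un_least[OF XY(1,2)] le_infI1[OF XY(1), of Y]
    by (simp_all add: dominated_def)
  ultimately show ?thesis using XY by (auto simp: tight_set_def)
qed

text \<open>Every point lies in a tight set, hence in a maximal one. Overlapping maximal tight sets
  have a tight union and therefore coincide.\<close>

lemma exists_tight_partition:
  assumes fin: "finite V" and sub: "intersecting_submodular V f"
  shows "\<exists>r Q. dominated V f r \<and> partition_on V Q \<and> (\<forall>D\<in>Q. sum r D = f D)"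
proof -
  obtain r where dom: "dominated V f r" and cov: "\<forall>i\<in>V. \<exists>X. i \<in> X \<and> tight_set V f r X"
    using exists_dominated_tight[OF fin, of f] by (elim exE conjE)
  let ?Q = "{X. tight_set V f r X \<and> (\<forall>Y. tight_set V f r Y \<longrightarrow> X \<subseteq> Y \<longrightarrow> Y = X)}"
  have "partition_on V ?Q"
  proof (rule partition_onI)
    show "\<Union>?Q = V"
    proof (intro equalityI subsetI)
      fix i assume "i \<in> V"
      then obtain X where X: "i \<in> X" "tight_set V f r X" using cov by blast
      have "finite {Y. tight_set V f r Y}"
        by (rule finite_subset[of _ "Pow V"]) (use fin in \<open>auto simp: tight_set_def\<close>)
      then obtain Y where "tight_set V f r Y" "X \<subseteq> Y" "\<forall>W. tight_set V f r W \<longrightarrow> Y \<subseteq> W \<longrightarrow> W = Y"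
        using finite_has_maximal2[of "{Y. tight_set V f r Y}" X] X(2) by (metis mem_Collect_eq)
      then show "i \<in> \<Union>?Q" using X(1) by blast
    qed (auto simp: tight_set_def)
    show "{} \<notin> ?Q" by (simp add: tight_set_def)
    fix X Y assume X: "X \<in> ?Q" and Y: "Y \<in> ?Q" and "X \<noteq> Y"
    show "disjnt X Y"
    proof (rule ccontr)
      assume "\<not> disjnt X Y"
      then have "tight_set V f r (X \<union> Y)"
        using tight_set_Un[OF fin sub dom, of X Y] X Y by (simp add: disjnt_def)
      then have "X \<union> Y = X" "X \<union> Y = Y" using X Y by simp_all
      then show False using \<open>X \<noteq> Y\<close> by simp
    qed
  qed
  moreover have "\<forall>D\<in>?Q. sum r D = f D" by (simp add: tight_set_def)
  ultimately show ?thesis using dom by blast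
qed

text \<open>Uncrosses \<open>X\<close> with one block after the other.\<close>

lemma sum_Int_partition_le:
  assumes sub: "intersecting_submodular V f"
    and "finite K" and "disjoint K" and "\<Union>K \<subseteq> V" and "X \<subseteq> V"
    and "\<And>C. C \<in> K \<Longrightarrow> X \<inter> C \<noteq> {}"
  shows "f (X \<union> \<Union>K) + (\<Sum>C\<in>K. f (X \<inter> C)) \<le> f X + (\<Sum>C\<in>K. f C)"
  using assms(2-)
proof (induction K rule: finite_induct)
  case (insert C K)
  have d: "C \<inter> \<Union>K = {}"
    using insert.prems(1) insert.hyps(2) by (auto simp: disjoint_def)
  have "disjoint K" using insert.prems(1) by (auto simp: disjoint_def)
  then have IH: "f (X \<union> \<Union>K) + (\<Sum>C\<in>K. f (X \<inter> C)) \<le> f X + (\<Sum>C\<in>K. f C)"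
    using insert.prems by (intro insert.IH) auto
  \<comment> \<open>The blocks already absorbed are disjoint from \<open>C\<close>, so the enlarged
    set meets \<open>C\<close> exactly where \<open>X\<close> does.\<close>
  have i: "(X \<union> \<Union>K) \<inter> C = X \<inter> C" using d by auto
  have u: "(X \<union> \<Union>K) \<union> C = X \<union> \<Union>(insert C K)" by auto
  have "f ((X \<union> \<Union>K) \<union> C) + f ((X \<union> \<Union>K) \<inter> C) \<le> f (X \<union> \<Union>K) + f C"
  proof (rule sub[unfolded intersecting_submodular_def, rule_format])
    show "X \<union> \<Union>K \<subseteq> V" "C \<subseteq> V" using insert.prems by auto
    show "(X \<union> \<Union>K) \<inter> C \<noteq> {}" using insert.prems(4)[of C] i by simp
  qed
  then show ?case using IH insert.hyps unfolding i u by simp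
qed simp

section \<open>Coarsening and refining a partition\<close>

lemma partition_on_merge:
  assumes "partition_on V P" and "K \<subseteq> P" and "K \<noteq> {}"
  shows "partition_on V (insert (\<Union>K) (P - K))"
proof (rule partition_onI)
  show "\<Union>(insert (\<Union>K) (P - K)) = V" using assms by (auto simp: partition_on_def)
  show "{} \<notin> insert (\<Union>K) (P - K)"
  proof -
    obtain C where "C \<in> K" using assms(3) by blast
    then have "C \<noteq> {}" "C \<subseteq> \<Union>K" using assms(2) partition_onD3[OF assms(1)] by auto
    then show ?thesis using partition_onD3[OF assms(1)] by auto
  qed
  have d: "disjnt p q" if "p \<in> P" "q \<in> P" "p \<noteq> q" for p q
    using partition_onD2[OF assms(1)] that by (auto simp: disjoint_def disjnt_def)
  have dK: "disjnt p (\<Union>K)" if "p \<in> P - K" for p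
    unfolding disjnt_Union2 using d that assms(2) by blast
  fix p q assume "p \<in> insert (\<Union>K) (P - K)" "q \<in> insert (\<Union>K) (P - K)" "p \<noteq> q"
  then show "disjnt p q" using d dK by (auto simp: disjnt_sym)
qed

text \<open>The second claim lets a sum over the refined partition split into the old blocks and the
  new pieces.\<close>

lemma partition_on_refine_block:
  assumes "partition_on V P" and "C \<in> P" and "partition_on C Q"
  shows "partition_on V ((P - {C}) \<union> Q)" and "(P - {C}) \<inter> Q = {}"
proof -
  have QC: "\<And>D. D \<in> Q \<Longrightarrow> D \<subseteq> C \<and> D \<noteq> {}" and PC: "\<And>D. D \<in> P - {C} \<Longrightarrow> D \<inter> C = {} \<and> D \<noteq> {}"
    using assms by (auto simp: partition_on_def disjoint_def)
  show "(P - {C}) \<inter> Q = {}"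
    using QC PC by blast
  show "partition_on V ((P - {C}) \<union> Q)"
  proof (rule partition_onI)
    show "\<Union>((P - {C}) \<union> Q) = V" using assms by (auto simp: partition_on_def)
    show "{} \<notin> (P - {C}) \<union> Q" using QC PC by blast
    have d: "disjnt p q" if "p \<in> P" "q \<in> P" "p \<noteq> q" for p q
      using partition_onD2[OF assms(1)] that by (auto simp: disjoint_def disjnt_def)
    have dQ: "disjnt p q" if "p \<in> Q" "q \<in> Q" "p \<noteq> q" for p q
      using partition_onD2[OF assms(3)] that by (auto simp: disjoint_def disjnt_def)
    have dPQ: "disjnt p q" if "p \<in> P - {C}" "q \<in> Q" for p q
      using QC[OF that(2)] PC[OF that(1)] by (auto simp: disjnt_def)
    fix p q assume "p \<in> (P - {C}) \<union> Q" "q \<in> (P - {C}) \<union> Q" "p \<noteq> q"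
    then consider "p \<in> P" "q \<in> P" | "p \<in> Q" "q \<in> Q" | "p \<in> P - {C}" "q \<in> Q" | "q \<in> P - {C}" "p \<in> Q"
      by fast
    then show "disjnt p q"
      using d dQ dPQ \<open>p \<noteq> q\<close> by cases (simp_all add: disjnt_sym)
  qed
qed

section \<open>The rate region and the value of \<open>R_ACO\<close>\<close>

text \<open>Complementation exchanges proper subsets with nonempty ones and lower bounds with upper
  bounds. The parameter of \<open>f_sharp\<close> is the total of the vector itself.\<close>

lemma R_CO_region_iff:
  assumes fin: "finite V" and ne: "V \<noteq> {}"
  shows "r \<in> R_CO_region V H \<longleftrightarrow> r \<in> extensional V \<and> dominated V (f_sharp V H (sum r V)) r"
proof -
  have sc: "sum r (V - X) = sum r V - sum r X" if "X \<subseteq> V" for X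
    using sum_diff[OF fin that, of r] .
  have un: "X \<union> (V - X) = V" if "X \<subseteq> V" for X using that by blast
  have "(\<forall>X. X \<subset> V \<longrightarrow> sum r X \<ge> cond_H H X (V - X)) \<longleftrightarrow>
      (\<forall>Y\<subseteq>V. Y \<noteq> {} \<longrightarrow> sum r Y \<le> f_sharp V H (sum r V) Y)" (is "?L \<longleftrightarrow> ?R")
  proof (intro iffI allI impI)
    fix Y assume L: ?L and Y: "Y \<subseteq> V" "Y \<noteq> {}"
    then have "V - Y \<subset> V" "V - (V - Y) = Y" by auto
    then have "cond_H H (V - Y) Y \<le> sum r (V - Y)" using L by metis
    moreover have "(V - Y) \<union> Y = V" using Y by blast
    ultimately have "H V - H Y \<le> sum r (V - Y)" by (simp add: cond_H_def)
    then show "sum r Y \<le> f_sharp V H (sum r V) Y" using sc[OF Y(1)] Y(2) by (simp add: f_sharp_def)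
  next
    fix X assume R: ?R and X: "X \<subset> V"
    then have "V - X \<subseteq> V" "V - X \<noteq> {}" by auto
    then have "sum r (V - X) \<le> sum r V - H V + H (V - X)" using R by (simp add: f_sharp_def)
    then show "cond_H H X (V - X) \<le> sum r X" using sc[of X] un[of X] X by (simp add: cond_H_def)
  qed
  then show ?thesis by (simp add: R_CO_region_def dominated_def)
qed

text \<open>Explains the form of \<open>phi\<close>: it is the value of \<alpha> at which the sum
  over the blocks equals \<alpha>, which is \<open>f_sharp V H \<alpha> V\<close> for nonempty
  \<open>V\<close>.\<close>

lemma sum_f_sharp_partition:
  assumes "Q \<in> nontrivial_partitions V"
  shows "(\<Sum>D\<in>Q. f_sharp V H \<alpha> D) = \<alpha> + (real (card Q) - 1) * (\<alpha> - phi V H Q)"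
proof -
  have Q: "partition_on V Q" "card Q > 1" using assms by (auto simp: nontrivial_partitions_def)
  have "(\<Sum>D\<in>Q. f_sharp V H \<alpha> D) = (\<Sum>D\<in>Q. \<alpha> - (H V - H D))"
    using partition_onD3[OF Q(1)] by (intro sum.cong) (auto simp: f_sharp_def)
  also have "\<dots> = real (card Q) * \<alpha> - (\<Sum>D\<in>Q. H V - H D)"
    by (simp add: sum_subtractf)
  also have "(\<Sum>D\<in>Q. H V - H D) = (real (card Q) - 1) * phi V H Q"
    using Q(2) by (simp add: phi_def sum_divide_distrib[symmetric])
  finally show ?thesis by (simp add: algebra_simps)
qed

text \<open>For a nontrivial partition the correction term in \<open>sum_f_sharp_partition\<close>
  is nonnegative; the only other partition is \<open>{V}\<close>, where equality holds.\<close>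

lemma f_sharp_le_sum_partition:
  assumes "finite V" and "V \<noteq> {}" and "partition_on V Q"
    and \<alpha>: "\<And>Q. Q \<in> nontrivial_partitions V \<Longrightarrow> phi V H Q \<le> \<alpha>"
  shows "\<alpha> \<le> (\<Sum>D\<in>Q. f_sharp V H \<alpha> D)"
proof (cases "card Q > 1")
  case True
  then have "Q \<in> nontrivial_partitions V" using assms by (simp add: nontrivial_partitions_def)
  then show ?thesis using sum_f_sharp_partition[of Q V H \<alpha>] \<alpha>[of Q] True by simp
next
  case False
  have "finite Q" "Q \<noteq> {}" using assms(1-3) finite_elements by (auto simp: partition_on_def)
  then have "card Q = 1" using False by (metis card_0_eq less_one linorder_neqE_nat)
  then obtain D where "Q = {D}" by (rule card_1_singletonE)
  then have "Q = {V}" using partition_onD1[OF assms(3)] by simp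
  then show ?thesis using assms(2) by (simp add: f_sharp_def)
qed

text \<open>For intersecting sets all four arguments are nonempty, so the constant
  \<open>\<alpha> - H V\<close> occurs twice on each side and cancels.\<close>

lemma intersecting_submodular_f_sharp:
  assumes "\<And>X Y. X \<subseteq> V \<Longrightarrow> Y \<subseteq> V \<Longrightarrow> H (X \<union> Y) + H (X \<inter> Y) \<le> H X + H Y"
  shows "intersecting_submodular V (f_sharp V H \<alpha>)"
  unfolding intersecting_submodular_def
proof (intro allI impI)
  fix X Y assume XY: "X \<subseteq> V" "Y \<subseteq> V" and ne: "X \<inter> Y \<noteq> {}"
  then have "X \<noteq> {}" "Y \<noteq> {}" "X \<union> Y \<noteq> {}" by auto
  then show "f_sharp V H \<alpha> (X \<union> Y) + f_sharp V H \<alpha> (X \<inter> Y) \<le> f_sharp V H \<alpha> X + f_sharp V H \<alpha> Y"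
    using assms[OF XY] ne by (simp add: f_sharp_def)
qed

lemma dominated_le_sum_partition:
  assumes "finite V" and "dominated V f r" and "partition_on X Q" and "X \<subseteq> V"
  shows "sum r X \<le> (\<Sum>D\<in>Q. f D)"
proof -
  have "sum r X = (\<Sum>D\<in>Q. sum r D)"
    using finite_subset[OF assms(4,1)] assms(3) by (rule sum_partition_on[symmetric])
  also have "\<dots> \<le> (\<Sum>D\<in>Q. f D)"
  proof (rule sum_mono)
    fix D assume "D \<in> Q"
    then have "D \<subseteq> V" "D \<noteq> {}" using assms(3,4) by (auto simp: partition_on_def)
    then show "sum r D \<le> f D" using assms(2) by (simp add: dominated_def)
  qed
  finally show ?thesis .
qed

lemma sum_restrict_subset:
  assumes "X \<subseteq> V"
  shows "sum (restrict r V) X = sum r X"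
  using assms by (intro sum.cong) auto

lemma dominated_restrict:
  assumes "dominated V f r" and "C \<subseteq> V"
  shows "dominated C f (restrict r C)"
  unfolding dominated_def
proof (intro allI impI)
  fix X assume "X \<subseteq> C" "X \<noteq> {}"
  then show "sum (restrict r C) X \<le> f X"
    using assms sum_restrict_subset[of X C r] by (auto simp: dominated_def)
qed

text \<open>A dominated vector with a partition into tight sets attains the value: its total is a
  partition sum of \<open>f_sharp\<close>, hence at least \<open>phi V H P\<close>, and domination
  at \<open>V\<close> gives the converse.\<close>

lemma R_ACO_eq_phi:
  assumes fin: "finite V" and ne: "V \<noteq> {}"
    and sub: "\<And>X Y. X \<subseteq> V \<Longrightarrow> Y \<subseteq> V \<Longrightarrow> H (X \<union> Y) + H (X \<inter> Y) \<le> H X + H Y"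
    and P: "phi_maximizer V H P"
  shows "R_ACO V H = phi V H P"
proof -
  let ?\<alpha> = "phi V H P"
  let ?f = "f_sharp V H ?\<alpha>"
  have le: "phi V H Q \<le> ?\<alpha>" if "Q \<in> nontrivial_partitions V" for Q
    using P that by (auto simp: phi_maximizer_def is_arg_max_def not_less)
  have Pn: "P \<in> nontrivial_partitions V"
    using P by (simp add: phi_maximizer_def is_arg_max_def)
  have fV: "?f V = ?\<alpha>" using ne by (simp add: f_sharp_def)
  obtain r Q where r: "dominated V ?f r" and Q: "partition_on V Q" "\<forall>D\<in>Q. sum r D = ?f D"
    using exists_tight_partition[OF fin intersecting_submodular_f_sharp[OF sub]] by blast
  have "sum r V = (\<Sum>D\<in>Q. ?f D)"
    using sum_partition_on[OF fin Q(1), of r] Q(2) by simp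
  then have "?\<alpha> \<le> sum r V"
    using f_sharp_le_sum_partition[OF fin ne Q(1) le] by simp
  moreover have "sum r V \<le> ?\<alpha>" using r ne fV by (auto simp: dominated_def)
  ultimately have rV: "sum r V = ?\<alpha>" by simp
  then have "restrict r V \<in> R_CO_region V H"
    using R_CO_region_iff[OF fin ne] dominated_restrict[OF r] by (simp add: sum_restrict_subset)
  then have "?\<alpha> \<in> (\<lambda>r. sum r V) ` R_CO_region V H"
    using rV by (intro image_eqI[of _ _ "restrict r V"]) (simp_all add: sum_restrict_subset)
  \<comment> \<open>Here the parameter of \<open>f_sharp\<close> is the competing total
    \<open>a\<close>; summing domination over the blocks of \<open>P\<close> bounds \<open>a\<close>
    from below.\<close>
  moreover have "?\<alpha> \<le> a" if "a \<in> (\<lambda>r. sum r V) ` R_CO_region V H" for a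
  proof -
    obtain s where s: "s \<in> R_CO_region V H" "a = sum s V" using \<open>a \<in> _\<close> by blast
    then have "dominated V (f_sharp V H a) s" using R_CO_region_iff[OF fin ne] by simp
    then have "a \<le> (\<Sum>D\<in>P. f_sharp V H a D)"
      using dominated_le_sum_partition[OF fin, of _ s V P] Pn s(2)
      by (simp add: nontrivial_partitions_def)
    then have "0 \<le> (real (card P) - 1) * (a - ?\<alpha>)"
      using sum_f_sharp_partition[OF Pn, of H a] by simp
    then show ?thesis
      using Pn by (simp add: nontrivial_partitions_def zero_le_mult_iff)
  qed
  ultimately show ?thesis unfolding R_ACO_def by (rule Least_equality)
qed

section \<open>Dilworth truncation and base polyhedra\<close>

lemma
  assumes "finite X" and "X \<subseteq> C"
  shows dilworth_truncation_le:
      "partition_on X Q \<Longrightarrow> dilworth_truncation (reduction C f) X \<le> (\<Sum>D\<in>Q. f D)"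
    and dilworth_truncation_attained:
      "\<exists>Q. partition_on X Q \<and> dilworth_truncation (reduction C f) X = (\<Sum>D\<in>Q. f D)"
proof -
  have red: "(\<Sum>D\<in>Q. reduction C f D) = (\<Sum>D\<in>Q. f D)" if "partition_on X Q" for Q
    using partition_onD1[OF that] assms(2) by (intro sum.cong) (auto simp: reduction_def)
  let ?S = "(\<lambda>Q. \<Sum>D\<in>Q. reduction C f D) ` {Q. partition_on X Q}"
  have fin: "finite ?S" using finitely_many_partition_on[OF assms(1)] by simp
  \<comment> \<open>The partition into singletons is a witness; for empty \<open>X\<close> it is the
    empty partition, with sum 0.\<close>
  have ne: "?S \<noteq> {}" using partition_on_singletons by blast
  show "dilworth_truncation (reduction C f) X \<le> (\<Sum>D\<in>Q. f D)" if "partition_on X Q"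
    unfolding dilworth_truncation_def red[OF that, symmetric]
    using that by (intro Min_le[OF fin]) blast
  show "\<exists>Q. partition_on X Q \<and> dilworth_truncation (reduction C f) X = (\<Sum>D\<in>Q. f D)"
    using Min_in[OF fin ne] red unfolding dilworth_truncation_def by auto
qed

text \<open>The truncation lies below \<open>f\<close> on nonempty sets, yet bounds every dominated
  vector, as summing over an optimal partition shows. The hypothesis on partitions of
  \<open>C\<close> makes both functions agree at \<open>C\<close>.\<close>

lemma base_polyhedron_dilworth_iff:
  assumes fin: "finite C" and ne: "C \<noteq> {}"
    and le: "\<And>Q. partition_on C Q \<Longrightarrow> f C \<le> (\<Sum>D\<in>Q. f D)"
  shows "r \<in> base_polyhedron C (dilworth_truncation (reduction C f)) \<longleftrightarrow>
    r \<in> extensional C \<and> dominated C f r \<and> sum r C = f C"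
proof -
  let ?h = "dilworth_truncation (reduction C f)"
  have hf: "?h X \<le> f X" if "X \<subseteq> C" "X \<noteq> {}" for X
    using dilworth_truncation_le[OF finite_subset[OF that(1) fin] that(1) partition_on_space[OF that(2)], of f]
    by simp
  obtain Q where "partition_on C Q" "?h C = (\<Sum>D\<in>Q. f D)"
    using dilworth_truncation_attained[OF fin order_refl] by blast
  then have hC: "?h C = f C" using le[of Q] hf[OF order_refl ne] by simp
  show ?thesis
  proof
    assume r: "r \<in> base_polyhedron C ?h"
    then have "dominated C f r"
      using hf unfolding dominated_def base_polyhedron_def by (auto intro: order_trans)
    then show "r \<in> extensional C \<and> dominated C f r \<and> sum r C = f C"
      using r hC by (simp add: base_polyhedron_def)
  next
    assume r: "r \<in> extensional C \<and> dominated C f r \<and> sum r C = f C"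
    \<comment> \<open>Includes empty \<open>X\<close>, where the optimal partition is empty and both
      sides are 0.\<close>
    have "sum r X \<le> ?h X" if X: "X \<subseteq> C" for X
    proof -
      obtain Q where Q: "partition_on X Q" "?h X = (\<Sum>D\<in>Q. f D)"
        using dilworth_truncation_attained[OF finite_subset[OF X fin] X] by blast
      then show ?thesis using dominated_le_sum_partition[OF fin _ Q(1) X, of f r] r by simp
    qed
    then show "r \<in> base_polyhedron C ?h" using r hC by (simp add: base_polyhedron_def)
  qed
qed

section \<open>Decomposition along a partition of minimal sum\<close>

lemma concat_vectors_block:
  assumes "disjoint P" and "C \<in> P" and "i \<in> C"
  shows "concat_vectors P r i = r C i"
proof -
  have "(THE D. D \<in> P \<and> i \<in> D) = C"
    using assms by (intro the_equality) (auto simp: disjoint_def)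
  then show ?thesis using assms by (auto simp: concat_vectors_def)
qed

text \<open>Abstracts the fundamental partition at the optimal rate: \<open>P\<close> minimises the
  sum of \<open>f\<close> over all partitions of \<open>V\<close>, and the minimum is
  \<open>f V\<close>.\<close>

locale tight_minimal_partition =
  fixes V :: "'i set" and f :: "'i set \<Rightarrow> real" and P :: "'i set set"
  assumes finite_V: "finite V"
    and submodular: "intersecting_submodular V f"
    and le_sum_partition: "\<And>Q. partition_on V Q \<Longrightarrow> f V \<le> (\<Sum>D\<in>Q. f D)"
    and partition_P: "partition_on V P"
    and sum_P: "(\<Sum>C\<in>P. f C) = f V"
begin

lemma finite_P: "finite P"
  using finite_V partition_P by (rule finite_elements)

lemma block_subset: "C \<in> P \<Longrightarrow> C \<subseteq> V"
  using partition_onD1[OF partition_P] by blast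

lemma block_nonempty: "C \<in> P \<Longrightarrow> C \<noteq> {}"
  using partition_onD3[OF partition_P] by blast

text \<open>Merging the blocks in \<open>K\<close> cannot bring the sum below that of
  \<open>P\<close>; the blocks outside \<open>K\<close> cancel.\<close>

lemma sum_blocks_le:
  assumes "K \<subseteq> P" and "K \<noteq> {}"
  shows "(\<Sum>C\<in>K. f C) \<le> f (\<Union>K)"
proof -
  \<comment> \<open>Ensures that inserting the merged block really adds one term to the sum.\<close>
  have "\<Union>K \<notin> P - K"
  proof
    assume U: "\<Union>K \<in> P - K"
    obtain C where C: "C \<in> K" using assms(2) by blast
    then have "C \<inter> \<Union>K = {}"
      using partition_onD2[OF partition_P] U assms(1) unfolding disjoint_def by (metis DiffD1 DiffD2 subsetD)
    moreover have "C \<subseteq> \<Union>K" "C \<noteq> {}" using C assms(1) block_nonempty by auto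
    ultimately show False by blast
  qed
  then have "f V \<le> f (\<Union>K) + (\<Sum>D\<in>P - K. f D)"
    using le_sum_partition[OF partition_on_merge[OF partition_P assms]] finite_P by simp
  then show ?thesis using sum.subset_diff[OF assms(1) finite_P, of f] sum_P by simp
qed

text \<open>Same comparison with \<open>C\<close> split into the pieces of \<open>Q\<close>. It
  provides the hypothesis under which truncation leaves the value at a block unchanged.\<close>

lemma block_le_sum_partition:
  assumes "C \<in> P" and "partition_on C Q"
  shows "f C \<le> (\<Sum>D\<in>Q. f D)"
proof -
  have "finite Q"
    using finite_elements[OF finite_subset[OF block_subset[OF assms(1)] finite_V] assms(2)] .
  then have "f V \<le> (\<Sum>D\<in>P - {C}. f D) + (\<Sum>D\<in>Q. f D)"
    using le_sum_partition[OF partition_on_refine_block(1)[OF partition_P assms]]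
      partition_on_refine_block(2)[OF partition_P assms] finite_P
    by (simp add: sum.union_disjoint)
  then show ?thesis using sum.remove[OF finite_P assms(1), of f] sum_P by simp
qed

text \<open>Blockwise the vector is at most \<open>f\<close>, and the totals over \<open>P\<close>
  agree, so no block can be strict.\<close>

lemma block_sum_eq:
  assumes "dominated V f r" and "sum r V = f V" and "C \<in> P"
  shows "sum r C = f C"
proof (rule sum_mono_inv[OF _ _ assms(3) finite_P])
  show "(\<Sum>C\<in>P. sum r C) = (\<Sum>C\<in>P. f C)"
    using sum_partition_on[OF finite_V partition_P, of r] sum_P assms(2) by simp
  show "sum r D \<le> f D" if "D \<in> P" for D
    using assms(1) block_subset[OF that] block_nonempty[OF that] by (simp add: dominated_def)
qed

lemma dominated_if_blocks_dominated:
  assumes "\<And>C. C \<in> P \<Longrightarrow> dominated C f r"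
  shows "dominated V f r"
  unfolding dominated_def
proof (intro allI impI)
  fix X assume X: "X \<subseteq> V" "X \<noteq> {}"
  \<comment> \<open>The blocks meeting \<open>X\<close> cover it, so uncrossing \<open>X\<close>
    with all of them ends at their union.\<close>
  let ?K = "{C \<in> P. X \<inter> C \<noteq> {}}"
  have K: "?K \<subseteq> P" "finite ?K" "disjoint ?K"
    using finite_P partition_onD2[OF partition_P] by (auto simp: disjoint_def)
  have XK: "X \<subseteq> \<Union>?K" using X(1) partition_onD1[OF partition_P] by blast
  then have Kne: "?K \<noteq> {}" using X(2) by blast
  have KV: "\<Union>?K \<subseteq> V" using block_subset by blast
  have "sum r X = (\<Sum>C\<in>?K. sum r (X \<inter> C))"
  proof -
    have "X = (\<Union>C\<in>?K. X \<inter> C)" using XK by blast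
    then have "sum r X = sum r (\<Union>C\<in>?K. X \<inter> C)" by simp
    also have "\<dots> = (\<Sum>C\<in>?K. sum r (X \<inter> C))"
      using K finite_subset[OF X(1) finite_V]
      by (intro sum.UNION_disjoint) (auto simp: disjoint_def)
    finally show ?thesis .
  qed
  also have "\<dots> \<le> (\<Sum>C\<in>?K. f (X \<inter> C))"
  proof (rule sum_mono)
    fix C assume "C \<in> ?K"
    then have "dominated C f r" "X \<inter> C \<noteq> {}" using assms by auto
    then show "sum r (X \<inter> C) \<le> f (X \<inter> C)" by (simp add: dominated_def)
  qed
  also have "\<dots> \<le> f X + (\<Sum>C\<in>?K. f C) - f (\<Union>?K)"
    using sum_Int_partition_le[OF submodular K(2,3) KV X(1)] Un_absorb1[OF XK] by simp
  \<comment> \<open>By \<open>sum_blocks_le\<close>, the blocks of \<open>?K\<close> together cost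
    no more than their union.\<close>
  also have "\<dots> \<le> f X"
    using sum_blocks_le[OF K(1) Kne] by simp
  finally show "sum r X \<le> f X" .
qed

text \<open>The concatenation is feasible because domination glues. Any competitor is tight on every
  block, so its restrictions compete in the block problems, and the separable costs add up over
  \<open>P\<close>.\<close>

lemma concat_minimizes:
  assumes "\<And>C. C \<in> P \<Longrightarrow> is_arg_min (separable g C)
      (\<lambda>r. r \<in> base_polyhedron C (dilworth_truncation (reduction C f))) (s C)"
  shows "is_arg_min (separable g V)
      (\<lambda>r. r \<in> extensional V \<and> dominated V f r \<and> sum r V = f V) (concat_vectors P s)"
proof -
  let ?r = "concat_vectors P s"
  have base: "r \<in> base_polyhedron C (dilworth_truncation (reduction C f)) \<longleftrightarrow>
      r \<in> extensional C \<and> dominated C f r \<and> sum r C = f C" if "C \<in> P" for C r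
    using that finite_subset[OF block_subset finite_V] block_nonempty block_le_sum_partition
    by (intro base_polyhedron_dilworth_iff) auto
  have s: "dominated C f (s C)" "sum (s C) C = f C" if "C \<in> P" for C
    using assms[OF that] base[OF that] by (auto simp: is_arg_min_def)
  have block: "?r i = s C i" if "C \<in> P" "i \<in> C" for C i
    using concat_vectors_block[OF partition_onD2[OF partition_P] that] .
  have sum_block: "sum ?r X = sum (s C) X" if "C \<in> P" "X \<subseteq> C" for C X
    using that by (intro sum.cong refl block) auto
  have "dominated V f ?r"
  proof (rule dominated_if_blocks_dominated)
    show "dominated C f ?r" if "C \<in> P" for C
      using s(1)[OF that] sum_block[OF that] by (simp add: dominated_def)
  qed
  moreover have "sum ?r V = f V"
    using sum_partition_on[OF finite_V partition_P, of ?r] sum_block s(2) sum_P by simp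
  moreover have "?r \<in> extensional V"
    using partition_onD1[OF partition_P] by (simp add: concat_vectors_def)
  moreover have "separable g V ?r \<le> separable g V r"
    if r: "dominated V f r" "sum r V = f V" for r
  proof -
    have sep: "separable g V q = (\<Sum>C\<in>P. separable g C q)" for q
      using sum_partition_on[OF finite_V partition_P, of "\<lambda>i. g i (q i)"] by (simp add: separable_def)
    have "separable g C ?r \<le> separable g C r" if C: "C \<in> P" for C
    proof -
      \<comment> \<open>Restriction makes the competitor extensional on \<open>C\<close> without
        changing its cost there.\<close>
      have "restrict r C \<in> base_polyhedron C (dilworth_truncation (reduction C f))"
        using base[OF C] dominated_restrict[OF r(1) block_subset[OF C]] block_sum_eq[OF r C]
        by (simp add: sum_restrict_subset)
      then have "separable g C (s C) \<le> separable g C (restrict r C)"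
        using assms[OF C] by (auto simp: is_arg_min_def not_less)
      then show ?thesis using block[OF C] by (simp add: separable_def)
    qed
    then show ?thesis unfolding sep by (rule sum_mono)
  qed
  ultimately show ?thesis by (auto simp: is_arg_min_def not_less)
qed

end

section \<open>Application to \<open>f_sharp\<close> at the optimal rate\<close>

text \<open>At \<alpha> equal to the maximum of \<open>phi\<close>, every partition sum is at least
  \<alpha>, and the correction term vanishes for \<open>P\<close>.\<close>

lemma tight_minimal_partition_f_sharp:
  assumes fin: "finite V" and ne: "V \<noteq> {}"
    and sub: "\<And>X Y. X \<subseteq> V \<Longrightarrow> Y \<subseteq> V \<Longrightarrow> H (X \<union> Y) + H (X \<inter> Y) \<le> H X + H Y"
    and P: "phi_maximizer V H P"
  shows "tight_minimal_partition V (f_sharp V H (phi V H P)) P"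
proof
  let ?\<alpha> = "phi V H P"
  have Pn: "P \<in> nontrivial_partitions V"
    and le: "\<And>Q. Q \<in> nontrivial_partitions V \<Longrightarrow> phi V H Q \<le> ?\<alpha>"
    using P by (auto simp: phi_maximizer_def is_arg_max_def not_less)
  have fV: "f_sharp V H ?\<alpha> V = ?\<alpha>" using ne by (simp add: f_sharp_def)
  show "finite V" by (rule fin)
  show "intersecting_submodular V (f_sharp V H ?\<alpha>)"
    by (rule intersecting_submodular_f_sharp[OF sub])
  show "f_sharp V H ?\<alpha> V \<le> (\<Sum>D\<in>Q. f_sharp V H ?\<alpha> D)" if "partition_on V Q" for Q
    unfolding fV by (rule f_sharp_le_sum_partition[OF fin ne that le])
  show "partition_on V P" using Pn by (simp add: nontrivial_partitions_def)
  show "(\<Sum>C\<in>P. f_sharp V H ?\<alpha> C) = f_sharp V H ?\<alpha> V"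
    unfolding fV using sum_f_sharp_partition[OF Pn, of H ?\<alpha>] by simp
qed

text \<open>Fixing the total turns the vector-dependent parameter of \<open>R_CO_region_iff\<close>
  into the constant \<open>R_ACO V H\<close>, which is also the value of \<open>f_sharp\<close> at
  the nonempty set \<open>V\<close>.\<close>

lemma R_ACO_region_iff:
  assumes fin: "finite V" and ne: "V \<noteq> {}"
  shows "r \<in> R_ACO_region V H \<longleftrightarrow> r \<in> extensional V \<and>
    dominated V (f_sharp V H (R_ACO V H)) r \<and> sum r V = f_sharp V H (R_ACO V H) V"
  using R_CO_region_iff[OF fin ne, of r H] ne by (auto simp: R_ACO_region_def f_sharp_def)

theorem mainTheorem8:
  fixes M :: "'m measure" and b :: real
    and V :: "'i set" and S :: "'i \<Rightarrow> 'z set" and Z :: "'i \<Rightarrow> 'm \<Rightarrow> 'z"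
    and H :: "'i set \<Rightarrow> real" and P :: "'i set set"
    and g :: "'i \<Rightarrow> real \<Rightarrow> real" and rstar :: "'i set \<Rightarrow> 'i \<Rightarrow> real"
  assumes "finite V" and "card V > 1"
    and "information_space M b"
    and "\<And>i. i \<in> V \<Longrightarrow> countable (S i)"
    and "\<And>i. i \<in> V \<Longrightarrow> Z i \<in> measurable M (count_space (S i))"
    and "\<And>X. X \<subseteq> V \<Longrightarrow>
           \<exists>p. information_space.finite_entropy M b (joint_alphabet S X) (joint_tuple Z X) p"
  defines "H \<equiv> joint_entropy M b S Z"
  assumes "fundamental_partition V H P"
    and "\<And>i. i \<in> V \<Longrightarrow> convex_on UNIV (g i)"
    and "\<And>C. C \<in> P \<Longrightarrow>
           is_arg_min (separable g C)
             (\<lambda>r. r \<in> base_polyhedron C (dilworth_truncation (reduction C (f_sharp V H (R_ACO V H)))))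
             (rstar C)"
  shows "is_arg_min (separable g V) (\<lambda>r. r \<in> R_ACO_region V H) (concat_vectors P rstar)"
proof -
  interpret information_space M b by fact
  have ne: "V \<noteq> {}" using assms(2) by auto
  have P: "phi_maximizer V H P" using assms(8) by (simp add: fundamental_partition_def)
  have sub: "H (X \<union> Y) + H (X \<inter> Y) \<le> H X + H Y" if "X \<subseteq> V" "Y \<subseteq> V" for X Y
    unfolding H_def using assms(1,4,6) that by (rule joint_entropy_submodular)
  \<comment> \<open>The partition facts are available at \<open>phi V H P\<close>;
    \<open>R_ACO_eq_phi\<close> transfers them to the optimal rate.\<close>
  interpret tight_minimal_partition V "f_sharp V H (R_ACO V H)" P
    using tight_minimal_partition_f_sharp[of V H, OF assms(1) ne sub P]
      R_ACO_eq_phi[of V H, OF assms(1) ne sub P] by simp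
  show ?thesis
    unfolding R_ACO_region_iff[OF assms(1) ne] using assms(10) by (rule concat_minimizes)
qed

end
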